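(* Let $X_1, X_2, \ldots$ be independent identically distributed real random variables with mean $0$, variance $\sigma^2 > 0$ and finite Poincaré constant $R_{X_i} = R$, and let $U_n = (X_1 + \cdots + X_n)/\sqrt{n\sigma^2}$. Let $c_0 = 1/(12\sqrt{R})$. Then for any $c < c_0$ and any continuous function $w : \mathbb{R} \to \mathbb{R}$ such that $|w(t)| \le \exp(c|t|)$ for all $t$, $$\mathbb{E}\, w(U_n) \to \mathbb{E}\, w(Z) \quad \text{as } n \to \infty,$$ where $Z$ is a standard normal random variable.
   Context: For a real random variable $Y$, the Poincaré constant is $$R_Y = \sup_{g \in H_1(Y)} \frac{\mathrm{Var}\, g(Y)}{\mathbb{E}\, g'(Y)^2},$$ where $H_1(Y)$ is the space of absolutely continuous functions $g$ on the real line such that $\mathrm{Var}\, g(Y) > 0$ and $\mathbb{E}\, g'(Y)^2 < \infty$. *)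

theory Defs
  imports "HOL-Probability.Probability"
begin

definition absolutely_continuous_on_interval :: "real \<Rightarrow> real \<Rightarrow> (real \<Rightarrow> real) \<Rightarrow> bool" where
  "absolutely_continuous_on_interval a b g \<longleftrightarrow>
     (\<forall>\<epsilon>>0. \<exists>\<delta>>0. \<forall>D :: (real \<times> real) set.
        finite D \<longrightarrow>
        (\<forall>(u, v)\<in>D. a \<le> u \<and> u \<le> v \<and> v \<le> b) \<longrightarrow>
        disjoint_family_on (\<lambda>(u, v). {u<..<v}) D \<longrightarrow>
        (\<Sum>(u, v)\<in>D. v - u) < \<delta> \<longrightarrow>
        (\<Sum>(u, v)\<in>D. \<bar>g v - g u\<bar>) < \<epsilon>)"

text \<open>On the real line, absolute continuity means absolute continuity on every compact
  interval (so that, for example, all smooth functions qualify).\<close>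

definition absolutely_continuous_fun :: "(real \<Rightarrow> real) \<Rightarrow> bool" where
  "absolutely_continuous_fun g \<longleftrightarrow> (\<forall>a b. absolutely_continuous_on_interval a b g)"

text \<open>An absolutely continuous function is differentiable outside a Lebesgue null set; on that
  exceptional set the derivative is given the value \<open>0\<close>.\<close>

definition ae_deriv :: "(real \<Rightarrow> real) \<Rightarrow> real \<Rightarrow> real" where
  "ae_deriv g x = (if g differentiable (at x) then deriv g x else 0)"

text \<open>The variance as an extended nonnegative real, infinite for a random variable that is not
  square integrable (the library's variance would be \<open>0\<close> there by the Bochner integral's
  convention).\<close>

definition ext_variance :: "'a measure \<Rightarrow> ('a \<Rightarrow> real) \<Rightarrow> ennreal" where
  "ext_variance M f =
     (if integrable M (\<lambda>\<omega>. (f \<omega>)\<^sup>2) then ennreal (prob_space.variance M f) else \<infinity>)"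

definition deriv_energy :: "'a measure \<Rightarrow> ('a \<Rightarrow> real) \<Rightarrow> (real \<Rightarrow> real) \<Rightarrow> ennreal" where
  "deriv_energy M Y g = (\<integral>\<^sup>+ \<omega>. ennreal ((ae_deriv g (Y \<omega>))\<^sup>2) \<partial>M)"

definition H1 :: "'a measure \<Rightarrow> ('a \<Rightarrow> real) \<Rightarrow> (real \<Rightarrow> real) set" where
  "H1 M Y = {g. absolutely_continuous_fun g \<and>
                ext_variance M (\<lambda>\<omega>. g (Y \<omega>)) > 0 \<and> deriv_energy M Y g < \<infinity>}"

text \<open>The quotient is formed in \<^typ>\<open>ennreal\<close>: a function in \<^const>\<open>H1\<close> whose derivative
  term is \<open>0\<close> makes the Poincare constant infinite.\<close>

definition poincare_constant :: "'a measure \<Rightarrow> ('a \<Rightarrow> real) \<Rightarrow> ennreal" where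
  "poincare_constant M Y =
     (SUP g\<in>H1 M Y. ext_variance M (\<lambda>\<omega>. g (Y \<omega>)) / deriv_energy M Y g)"

end

(*
  Let h = exp(k min(|x|, K)). Since |h'| <= k h, the Poincare inequality with R k^2 <= 1/4 gives
  E h(X)^2 - (E h(X))^2 <= E h(X)^2 / 4, and splitting E h(X) at a level A proportional to E|X|
  turns this into a bound on E h(X)^2 that does not depend on K; hence E exp(2k|X|) is finite.
  As the X_i are centred, E exp(t X_i) <= exp(D t^2) for small t, so that E exp(s |U_n|) is bounded
  by 2 exp(D s^2 / sigma^2) for large n, whatever s is. With s = 2 max(0, c) this bounds
  E w(U_n)^2, and the resulting uniform integrability upgrades the weak convergence given by
  the central limit theorem to convergence of E w(U_n).
*)

theory Submission
  imports Defs "HOL-Real_Asymp.Real_Asymp"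
begin

section \<open>Regularity of the test functions \<open>exp (k * min \<bar>x\<bar> K)\<close>\<close>

lemma lipschitz_imp_absolutely_continuous_fun:
  fixes g :: "real \<Rightarrow> real"
  assumes L: "\<And>u v. \<bar>g v - g u\<bar> \<le> L * \<bar>v - u\<bar>"
  shows "absolutely_continuous_fun g"
  unfolding absolutely_continuous_fun_def absolutely_continuous_on_interval_def
proof (intro allI impI)
  fix a b \<epsilon> :: real
  assume "\<epsilon> > 0"
  have "L \<ge> 0"
    using L[of 1 0] by simp
  show "\<exists>\<delta>>0. \<forall>D :: (real \<times> real) set. finite D \<longrightarrow>
        (\<forall>(u, v)\<in>D. a \<le> u \<and> u \<le> v \<and> v \<le> b) \<longrightarrow>
        disjoint_family_on (\<lambda>(u, v). {u<..<v}) D \<longrightarrow>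
        (\<Sum>(u, v)\<in>D. v - u) < \<delta> \<longrightarrow> (\<Sum>(u, v)\<in>D. \<bar>g v - g u\<bar>) < \<epsilon>"
  \<comment> \<open>The denominator is \<open>L + 1\<close> rather than \<open>L\<close> so that the
    case \<open>L = 0\<close> is covered.\<close>
  proof (intro exI[of _ "\<epsilon> / (L + 1)"] conjI allI impI)
    show "\<epsilon> / (L + 1) > 0"
      using \<open>\<epsilon> > 0\<close> \<open>L \<ge> 0\<close> by simp
    fix D :: "(real \<times> real) set"
    assume D: "\<forall>(u, v)\<in>D. a \<le> u \<and> u \<le> v \<and> v \<le> b"
      and less: "(\<Sum>(u, v)\<in>D. v - u) < \<epsilon> / (L + 1)"
    have "(\<Sum>(u, v)\<in>D. \<bar>g v - g u\<bar>) \<le> (\<Sum>(u, v)\<in>D. L * (v - u))"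
    proof (rule sum_mono)
      fix p assume "p \<in> D"
      moreover obtain u v where "p = (u, v)"
        by (rule prod.exhaust)
      ultimately have "u \<le> v"
        using D by blast
      then show "(case p of (u, v) \<Rightarrow> \<bar>g v - g u\<bar>) \<le> (case p of (u, v) \<Rightarrow> L * (v - u))"
        using L[where u = u and v = v] \<open>p = (u, v)\<close> by simp
    qed
    also have "\<dots> = L * (\<Sum>(u, v)\<in>D. v - u)"
      unfolding sum_distrib_left by (intro sum.cong) auto
    also have "\<dots> \<le> (L + 1) * (\<Sum>(u, v)\<in>D. v - u)"
      using D by (intro mult_right_mono sum_nonneg) auto
    also have "\<dots> < \<epsilon>"
      using less \<open>L \<ge> 0\<close> pos_less_divide_eq[of "L + 1"]
      by (simp only: mult.commute[of "L + 1"])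
    finally show "(\<Sum>(u, v)\<in>D. \<bar>g v - g u\<bar>) < \<epsilon>" .
  qed
qed

text \<open>This combines \<open>1 - exp (- d) \<le> d\<close> with the fact that
  \<open>min \<bar>x\<bar> K\<close> is 1-Lipschitz. Keeping the maximum of the two values as a
  factor serves two purposes: bounded by a constant, it gives a global Lipschitz bound; as the
  points merge, it gives the sharper pointwise bound on the derivative.\<close>

lemma exp_min_abs_diff_le:
  fixes k K u v :: real
  assumes "k \<ge> 0"
  shows "\<bar>exp (k * min \<bar>v\<bar> K) - exp (k * min \<bar>u\<bar> K)\<bar>
    \<le> k * max (exp (k * min \<bar>u\<bar> K)) (exp (k * min \<bar>v\<bar> K)) * \<bar>v - u\<bar>"
proof -
  let ?h = "\<lambda>x. exp (k * min \<bar>x\<bar> K)"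
  have ineq: "?h v - ?h u \<le> k * max (?h u) (?h v) * \<bar>v - u\<bar>" for u v
  proof -
    let ?d = "k * (min \<bar>v\<bar> K) - k * (min \<bar>u\<bar> K)"
    have "?h u = ?h v * exp (- ?d)"
      unfolding exp_add[symmetric] by simp
    then have "?h v - ?h u = ?h v * (1 - exp (- ?d))"
      by (simp only: right_diff_distrib mult_1_right)
    also have "\<dots> \<le> ?h v * ?d"
      by (intro mult_left_mono exp_ge_zero) (use exp_ge_add_one_self[of "- ?d"] in linarith)
    also have "\<dots> \<le> ?h v * (k * \<bar>v - u\<bar>)"
      unfolding right_diff_distrib[symmetric] using assms by (intro mult_left_mono) auto
    also have "\<dots> \<le> max (?h u) (?h v) * (k * \<bar>v - u\<bar>)"
      using assms by (intro mult_right_mono) auto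
    finally show ?thesis by (simp only: mult_ac)
  qed
  show ?thesis
    using ineq[of v u] ineq[of u v] unfolding abs_le_iff
    by (simp only: abs_minus_commute[of u v] max.commute minus_diff_eq)
qed

text \<open>Difference quotients are bounded by \<open>L y\<close>, so the derivative is bounded by
  the limit. Points without a derivative have \<open>ae_deriv\<close> equal to 0, which is where
  \<open>l \<ge> 0\<close> enters. Kinks of the test function thus need no computation.\<close>

lemma abs_ae_deriv_le_of_local_lipschitz:
  assumes "eventually (\<lambda>y. \<bar>g y - g x\<bar> \<le> L y * \<bar>y - x\<bar>) (at x)" "(L \<longlongrightarrow> l) (at x)"
    and "l \<ge> 0"
  shows "\<bar>ae_deriv g x\<bar> \<le> l"
proof (cases "g differentiable (at x)")
  case True
  then have "(g has_field_derivative deriv g x) (at x)"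
    by (metis DERIV_imp_deriv real_differentiableE)
  then have "((\<lambda>y. (g y - g x) / (y - x)) \<longlongrightarrow> deriv g x) (at x)"
    by (simp add: has_field_derivative_iff)
  then have "((\<lambda>y. \<bar>(g y - g x) / (y - x)\<bar>) \<longlongrightarrow> \<bar>deriv g x\<bar>) (at x)"
    by (rule tendsto_rabs)
  moreover have "eventually (\<lambda>y. \<bar>(g y - g x) / (y - x)\<bar> \<le> L y) (at x)"
    using assms(1) eventually_at_topological[of "\<lambda>y. y \<noteq> x" x UNIV]
    by (auto elim!: eventually_rev_mp simp: eventually_at_filter abs_divide field_simps)
  ultimately have "\<bar>deriv g x\<bar> \<le> l"
    using assms(2) by (intro tendsto_le[OF _ assms(2)]) auto
  then show ?thesis
    using True by (simp add: ae_deriv_def)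
qed (simp add: ae_deriv_def assms(3))

lemma abs_ae_deriv_exp_min_abs_le:
  fixes k K x :: real
  assumes "k \<ge> 0"
  shows "\<bar>ae_deriv (\<lambda>x. exp (k * min \<bar>x\<bar> K)) x\<bar> \<le> k * exp (k * min \<bar>x\<bar> K)"
proof -
  let ?h = "\<lambda>x. exp (k * min \<bar>x\<bar> K)"
  have "((\<lambda>y. k * max (?h x) (?h y)) \<longlongrightarrow> k * max (?h x) (?h x)) (at x)"
    by (intro tendsto_intros)
  then show ?thesis
    using assms exp_min_abs_diff_le[OF assms]
    by (intro abs_ae_deriv_le_of_local_lipschitz[where L = "\<lambda>y. k * max (?h x) (?h y)"]) auto
qed

section \<open>From the Poincare inequality to exponential moments\<close>

text \<open>Fatou's lemma for Bochner integrals. It serves to remove truncations, first in the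
  exponential moment of one variable and later in the moment bound for a weak limit.\<close>

lemma integrable_expectation_le_of_tendsto:
  fixes f :: "'a \<Rightarrow> real" and f' :: "nat \<Rightarrow> 'a \<Rightarrow> real"
  assumes int: "\<And>n. integrable M (f' n)" and nonneg: "\<And>n x. f' n x \<ge> 0"
    and lim: "\<And>x. (\<lambda>n. f' n x) \<longlonglongrightarrow> f x" and bound: "\<And>n. integral\<^sup>L M (f' n) \<le> C"
  shows "integrable M f" "integral\<^sup>L M f \<le> C"
proof -
  have [measurable]: "f' n \<in> borel_measurable M" for n
    using int by blast
  have [measurable]: "f \<in> borel_measurable M"
    by (rule borel_measurable_LIMSEQ_real[of _ f']) (use lim in auto)
  have f_nonneg: "f x \<ge> 0" for x
    using lim nonneg by (meson LIMSEQ_le_const)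
  have "0 \<le> integral\<^sup>L M (f' 0)"
    by (simp add: nonneg)
  then have "C \<ge> 0"
    using bound[of 0] by linarith
  have "ennreal (f x) = liminf (\<lambda>n. ennreal (f' n x))" for x
    by (rule lim_imp_Liminf[symmetric]) (auto intro!: tendsto_ennrealI lim)
  then have "(\<integral>\<^sup>+ x. ennreal (f x) \<partial>M) = (\<integral>\<^sup>+ x. liminf (\<lambda>n. ennreal (f' n x)) \<partial>M)"
    by simp
  also have "\<dots> \<le> liminf (\<lambda>n. \<integral>\<^sup>+ x. ennreal (f' n x) \<partial>M)"
    by (rule nn_integral_liminf) simp
  also have "\<dots> \<le> liminf (\<lambda>n. ennreal C)"
    using bound by (intro Liminf_mono always_eventually allI)
      (simp add: nn_integral_eq_integral int nonneg ennreal_leI)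
  also have "\<dots> = ennreal C"
    by (simp add: Liminf_const)
  finally have le: "(\<integral>\<^sup>+ x. ennreal (f x) \<partial>M) \<le> ennreal C" .
  show "integrable M f"
    using le f_nonneg by (intro integrableI_nonneg) (auto simp: less_top[symmetric] top_unique)
  then show "integral\<^sup>L M f \<le> C"
    using le f_nonneg \<open>C \<ge> 0\<close> by (simp add: nn_integral_eq_integral)
qed

text \<open>In \<open>ennreal\<close>, a positive \<open>V\<close> divided by 0 is infinite, so a
  finite bound on the quotient excludes \<open>E = 0\<close> and the division can be undone.\<close>

lemma ennreal_le_times_of_divide_le:
  fixes V E :: ennreal
  assumes "V / E \<le> ennreal R" "V > 0" "E < \<infinity>"
  shows "V \<le> ennreal R * E"
proof -
  have "E \<noteq> 0"
    using assms(1,2) by (auto simp: top_unique split: if_splits)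
  then have "V = V / E * E"
    using assms(3) by (simp add: ennreal_divide_times)
  also have "\<dots> \<le> ennreal R * E"
    by (intro mult_right_mono assms(1)) simp
  finally show ?thesis .
qed

text \<open>The Poincare inequality in real numbers. The majorant \<open>G\<close> makes the energy
  finite, and comparing nonnegative integrals avoids any discussion of the measurability of
  \<open>ae_deriv g\<close>.\<close>

lemma (in prob_space) poincare_variance_le:
  fixes Y :: "'a \<Rightarrow> real" and g G :: "real \<Rightarrow> real"
  assumes R: "R \<ge> 0" "poincare_constant M Y \<le> ennreal R"
    and g: "absolutely_continuous_fun g" "integrable M (\<lambda>\<omega>. (g (Y \<omega>))\<^sup>2)"
    and G: "integrable M (\<lambda>\<omega>. (G (Y \<omega>))\<^sup>2)" "\<And>x. \<bar>ae_deriv g x\<bar> \<le> G x"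
  shows "variance (\<lambda>\<omega>. g (Y \<omega>)) \<le> R * expectation (\<lambda>\<omega>. (G (Y \<omega>))\<^sup>2)"
\<comment> \<open>Membership in \<open>H1\<close> requires positive variance; with variance 0 the
  claim only says that the right-hand side is nonnegative.\<close>
proof (cases "variance (\<lambda>\<omega>. g (Y \<omega>)) > 0")
  case True
  let ?V = "ext_variance M (\<lambda>\<omega>. g (Y \<omega>))" and ?E = "deriv_energy M Y g"
  have V: "?V = ennreal (variance (\<lambda>\<omega>. g (Y \<omega>)))"
    using g(2) by (simp add: ext_variance_def)
  have "(ae_deriv g x)\<^sup>2 \<le> (G x)\<^sup>2" for x
    using power_mono[OF G(2)[of x] abs_ge_zero, of 2] by simp
  then have "?E \<le> (\<integral>\<^sup>+ \<omega>. ennreal ((G (Y \<omega>))\<^sup>2) \<partial>M)"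
    unfolding deriv_energy_def by (intro nn_integral_mono ennreal_leI)
  also have "\<dots> = ennreal (expectation (\<lambda>\<omega>. (G (Y \<omega>))\<^sup>2))"
    using G(1) by (intro nn_integral_eq_integral) auto
  finally have E: "?E \<le> ennreal (expectation (\<lambda>\<omega>. (G (Y \<omega>))\<^sup>2))" .
  then have "?E < \<infinity>"
    by (auto simp: less_top[symmetric] top_unique)
  then have "g \<in> H1 M Y"
    using g(1) True V by (simp add: H1_def)
  then have "?V / ?E \<le> ennreal R"
    using order_trans[OF SUP_upper[of g "H1 M Y"] R(2)[unfolded poincare_constant_def]] by blast
  then have "?V \<le> ennreal R * ?E"
    using True \<open>?E < \<infinity>\<close> by (intro ennreal_le_times_of_divide_le) (simp_all only: V ennreal_less_zero_iff infinity_ennreal_def)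
  also have "\<dots> \<le> ennreal R * ennreal (expectation (\<lambda>\<omega>. (G (Y \<omega>))\<^sup>2))"
    by (intro mult_left_mono E) simp
  also have "\<dots> = ennreal (R * expectation (\<lambda>\<omega>. (G (Y \<omega>))\<^sup>2))"
    by (rule ennreal_mult[symmetric]) (use R(1) in simp_all)
  finally show ?thesis
    unfolding V by (subst (asm) ennreal_le_iff) (use R(1) in simp_all)
next
  case False
  then show ?thesis
    using R(1) by (meson Bochner_Integration.integral_nonneg mult_nonneg_nonneg not_less order_trans zero_le_power2)
qed

text \<open>With \<open>m\<close> and \<open>F\<close> the first and second moments of the truncated
  exponential, the Poincare inequality bounds \<open>F\<close> by 4/3 of the square of
  \<open>m\<close>. Feeding this into an upper bound for \<open>m\<close> in terms of
  \<open>F\<close> leaves a coefficient of \<open>m\<close> below 1 on the right, so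
  \<open>m\<close> can be absorbed.\<close>

lemma (in prob_space) poincare_imp_exp_moment:
  fixes X :: "'a \<Rightarrow> real"
  assumes X: "integrable M X"
    and R: "R \<ge> 0" "poincare_constant M X \<le> ennreal R"
    and k: "k \<ge> 0" "R * k\<^sup>2 \<le> 1 / 4"
  shows "integrable M (\<lambda>\<omega>. exp (2 * k * \<bar>X \<omega>\<bar>))"
proof -
  have [measurable]: "X \<in> borel_measurable M"
    using X by blast
  \<comment> \<open>Truncation at \<open>K\<close> makes the function bounded and Lipschitz, so all
    moments below are finite from the start; what matters is that the final bound is free of
    \<open>K\<close>.\<close>
  define h where "h K x = exp (k * min \<bar>x\<bar> (real K))" for K x
  have [measurable]: "h K \<in> borel_measurable borel" for K
    unfolding h_def by measurable
  define a where "a = expectation (\<lambda>\<omega>. \<bar>X \<omega>\<bar>)"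
  \<comment> \<open>This level makes \<open>a / A\<close> at most 1/2, and the summand 1 keeps it
    positive when \<open>a = 0\<close>.\<close>
  define A where "A = 2 * a + 1"
  define B where "B = exp (k * A)"
  have "a \<ge> 0"
    by (simp add: a_def)
  then have "A > 0" "a / A \<le> 1 / 2"
    by (simp_all add: A_def field_simps)
  have h_ge: "h K x \<ge> 1" for K x
    using k(1) by (simp add: h_def)
  have h_le: "h K x \<le> exp (k * real K)" for K x
    using k(1) by (auto simp: h_def intro!: mult_left_mono)
  have int1: "integrable M (\<lambda>\<omega>. h K (X \<omega>))" for K
  proof (rule integrable_const_bound[where B = "exp (k * real K)"])
    show "AE \<omega> in M. norm (h K (X \<omega>)) \<le> exp (k * real K)"
      using h_le by (simp add: h_def)
  qed measurable
  have int2: "integrable M (\<lambda>\<omega>. (h K (X \<omega>))\<^sup>2)" for K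
  proof (rule integrable_const_bound[where B = "(exp (k * real K))\<^sup>2"])
    have "(h K x)\<^sup>2 \<le> (exp (k * real K))\<^sup>2" for x
      using h_le[of K x] h_ge[of K x] by (intro power_mono) auto
    then show "AE \<omega> in M. norm ((h K (X \<omega>))\<^sup>2) \<le> (exp (k * real K))\<^sup>2"
      by simp
  qed measurable
  have bound: "expectation (\<lambda>\<omega>. (h K (X \<omega>))\<^sup>2) \<le> 48 * B\<^sup>2" for K
  proof -
    define m where "m = expectation (\<lambda>\<omega>. h K (X \<omega>))"
    define F where "F = expectation (\<lambda>\<omega>. (h K (X \<omega>))\<^sup>2)"
    have "F \<ge> 0"
      by (simp add: F_def)
    have "m \<ge> 1"
      unfolding m_def using int1[of K] h_ge by (intro integral_ge_const) auto
    have "absolutely_continuous_fun (h K)"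
    proof (rule lipschitz_imp_absolutely_continuous_fun)
      fix u v :: real
      have "\<bar>h K v - h K u\<bar> \<le> k * max (h K u) (h K v) * \<bar>v - u\<bar>"
        unfolding h_def using exp_min_abs_diff_le[OF k(1)] by blast
      also have "\<dots> \<le> k * exp (k * K) * \<bar>v - u\<bar>"
        using k(1) h_le by (intro mult_right_mono mult_left_mono) auto
      finally show "\<bar>h K v - h K u\<bar> \<le> k * exp (k * K) * \<bar>v - u\<bar>" .
    qed
    moreover have "\<bar>ae_deriv (h K) x\<bar> \<le> k * h K x" for x
      unfolding h_def using abs_ae_deriv_exp_min_abs_le[OF k(1)] by blast
    ultimately have "variance (\<lambda>\<omega>. h K (X \<omega>)) \<le> R * expectation (\<lambda>\<omega>. (k * h K (X \<omega>))\<^sup>2)"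
      using int2 by (intro poincare_variance_le[OF R]) (auto simp: power_mult_distrib)
    also have "\<dots> = R * k\<^sup>2 * F"
      by (simp add: power_mult_distrib F_def)
    also have "\<dots> \<le> 1 / 4 * F"
      using k(2) \<open>F \<ge> 0\<close> by (intro mult_right_mono)
    finally have F_le: "F - m\<^sup>2 \<le> 1 / 4 * F"
      using int1 int2 by (simp add: variance_eq F_def m_def)
    \<comment> \<open>Where \<open>\<bar>x\<bar> > A\<close> this is AM-GM; Markov's inequality is built into the last summand.\<close>
    have "h K x \<le> B + (h K x)\<^sup>2 / (4 * m) + m * (\<bar>x\<bar> / A)" for x
    proof (cases "\<bar>x\<bar> \<le> A")
      case True
      then have "h K x \<le> B"
        using k(1) by (auto simp: h_def B_def intro!: mult_left_mono)
      moreover have "0 \<le> (h K x)\<^sup>2 / (4 * m)" "0 \<le> m * (\<bar>x\<bar> / A)"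
        using \<open>m \<ge> 1\<close> \<open>A > 0\<close> by simp_all
      ultimately show ?thesis by linarith
    next
      case False
      have "0 \<le> (h K x - 2 * m)\<^sup>2"
        by simp
      then have "h K x * (4 * m) \<le> (h K x)\<^sup>2 + m * (4 * m)"
        by (simp add: power2_eq_square algebra_simps)
      then have "h K x \<le> ((h K x)\<^sup>2 + m * (4 * m)) / (4 * m)"
        using \<open>m \<ge> 1\<close> by (subst pos_le_divide_eq) auto
      also have "\<dots> = (h K x)\<^sup>2 / (4 * m) + m"
        using \<open>m \<ge> 1\<close> by (simp add: add_divide_distrib)
      finally have "h K x \<le> (h K x)\<^sup>2 / (4 * m) + m" .
      moreover have "m * 1 \<le> m * (\<bar>x\<bar> / A)"
        using False \<open>m \<ge> 1\<close> \<open>A > 0\<close> by (intro mult_left_mono) auto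
      moreover have "B \<ge> 0"
        by (simp add: B_def)
      ultimately show ?thesis by linarith
    qed
    then have "m \<le> expectation (\<lambda>\<omega>. B + (h K (X \<omega>))\<^sup>2 / (4 * m) + m * (\<bar>X \<omega>\<bar> / A))"
      using int1 int2 X by (subst m_def, intro integral_mono) auto
    also have "\<dots> = B + F / (4 * m) + m * (a / A)"
      using int2 X by (simp add: F_def a_def prob_space)
    also have "\<dots> \<le> B + F / (4 * m) + m * (1 / 2)"
      using \<open>m \<ge> 1\<close> \<open>a / A \<le> 1 / 2\<close> by (intro add_left_mono mult_left_mono) auto
    finally have "m / 2 \<le> B + F / (4 * m)"
      by simp
    \<comment> \<open>This is where the variance bound enters: 1/2 - 1/3 = 1/6 of \<open>m\<close>
      remains on the left, hence the 6 below, and 4/3 times 36 gives the 48 of the claim.\<close>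
    also have "F / (4 * m) \<le> m / 3"
      using F_le \<open>m \<ge> 1\<close> by (simp add: field_simps power2_eq_square)
    finally have "m \<le> 6 * B"
      by simp
    then have "m\<^sup>2 \<le> (6 * B)\<^sup>2"
      using \<open>m \<ge> 1\<close> by (intro power_mono) auto
    then show ?thesis
      using F_le by (simp add: F_def power_mult_distrib)
  qed
  show ?thesis
  proof (rule integrable_expectation_le_of_tendsto(1)[OF int2 _ _ bound])
    fix \<omega>
    have "eventually (\<lambda>K. real K \<ge> \<bar>X \<omega>\<bar>) sequentially"
      using eventually_ge_at_top[of "nat \<lceil>\<bar>X \<omega>\<bar>\<rceil>"] by eventually_elim linarith
    \<comment> \<open>Once \<open>K\<close> exceeds \<open>\<bar>X \<omega>\<bar>\<close> the
      truncation is inactive, and squaring doubles the exponent.\<close>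
    then have "eventually (\<lambda>K. (h K (X \<omega>))\<^sup>2 = exp (2 * k * \<bar>X \<omega>\<bar>)) sequentially"
      by eventually_elim (simp add: h_def min_def mult.assoc flip: exp_double)
    then show "(\<lambda>K. (h K (X \<omega>))\<^sup>2) \<longlonglongrightarrow> exp (2 * k * \<bar>X \<omega>\<bar>)"
      by (rule tendsto_eventually)
  qed simp
qed

section \<open>Moment generating functions\<close>

text \<open>The exponent \<open>l * \<bar>x\<bar>\<close> is spent in two halves: one dominates the
  exponential in the Taylor remainder, the other absorbs the factor \<open>x\<^sup>2\<close> through
  \<open>u\<^sup>2 / 2 \<le> exp u\<close> with \<open>u = l * \<bar>x\<bar> / 2\<close>, whence the
  constant \<open>8 / l\<^sup>2\<close>. The linear term stays exact so that it can vanish in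
  expectation.\<close>

lemma exp_mult_le_quadratic:
  fixes l t x :: real
  assumes "l > 0" "\<bar>t\<bar> \<le> l / 2"
  shows "exp (t * x) \<le> 1 + t * x + t\<^sup>2 * (8 / l\<^sup>2 * exp (l * \<bar>x\<bar>))"
proof -
  obtain \<theta> where \<theta>: "\<bar>\<theta>\<bar> \<le> \<bar>t * x\<bar>" "exp (t * x) = 1 + t * x + exp \<theta> / 2 * (t * x)\<^sup>2"
    using Maclaurin_exp_le[of "t * x" 2] by (auto simp: numeral_2_eq_2)
  let ?u = "l * \<bar>x\<bar> / 2"
  have "\<bar>t * x\<bar> \<le> ?u"
    using mult_right_mono[OF assms(2), of "\<bar>x\<bar>"] by (simp add: abs_mult)
  then have "exp \<theta> \<le> exp ?u"
    using \<theta>(1) by simp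
  moreover have "?u\<^sup>2 / 2 \<le> exp ?u"
    using exp_lower_Taylor_quadratic[of ?u] mult_nonneg_nonneg[of l "\<bar>x\<bar>"] assms(1) by linarith
  then have "x\<^sup>2 \<le> 8 / l\<^sup>2 * exp ?u"
    using assms(1) by (simp add: field_simps power2_eq_square)
  ultimately have "exp \<theta> * x\<^sup>2 \<le> exp ?u * (8 / l\<^sup>2 * exp ?u)"
    by (intro mult_mono) auto
  also have "\<dots> = 8 / l\<^sup>2 * exp (l * \<bar>x\<bar>)"
    by (simp add: mult_exp_exp)
  finally have "t\<^sup>2 * (exp \<theta> * x\<^sup>2) \<le> t\<^sup>2 * (8 / l\<^sup>2 * exp (l * \<bar>x\<bar>))"
    by (rule mult_left_mono) simp
  moreover have "exp \<theta> / 2 * (t * x)\<^sup>2 \<le> t\<^sup>2 * (exp \<theta> * x\<^sup>2)"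
    by (simp add: power_mult_distrib)
  ultimately show ?thesis
    using \<theta>(2) by linarith
qed

text \<open>Centring removes the linear term, and \<open>1 + y \<le> exp y\<close> puts the bound in
  a form that multiplies well over independent variables.\<close>

lemma (in prob_space) nn_integral_exp_le_exp_quadratic:
  fixes X :: "'a \<Rightarrow> real"
  assumes X: "integrable M X" "expectation X = 0"
    and l: "l > 0" "integrable M (\<lambda>\<omega>. exp (l * \<bar>X \<omega>\<bar>))" and t: "\<bar>t\<bar> \<le> l / 2"
  shows "(\<integral>\<^sup>+ \<omega>. ennreal (exp (t * X \<omega>)) \<partial>M)
    \<le> ennreal (exp (t\<^sup>2 * (8 / l\<^sup>2 * expectation (\<lambda>\<omega>. exp (l * \<bar>X \<omega>\<bar>)))))"
proof -
  let ?q = "\<lambda>\<omega>. 1 + t * X \<omega> + t\<^sup>2 * (8 / l\<^sup>2 * exp (l * \<bar>X \<omega>\<bar>))"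
  have le: "exp (t * X \<omega>) \<le> ?q \<omega>" for \<omega>
    using exp_mult_le_quadratic[OF l(1) t] .
  have "(\<integral>\<^sup>+ \<omega>. ennreal (exp (t * X \<omega>)) \<partial>M) \<le> (\<integral>\<^sup>+ \<omega>. ennreal (?q \<omega>) \<partial>M)"
    by (intro nn_integral_mono ennreal_leI le)
  also have "\<dots> = ennreal (expectation ?q)"
    using X l(2) order_trans[OF exp_ge_zero le] by (intro nn_integral_eq_integral) auto
  also have "expectation ?q = 1 + t\<^sup>2 * (8 / l\<^sup>2 * expectation (\<lambda>\<omega>. exp (l * \<bar>X \<omega>\<bar>)))"
    using X l(2) by (simp add: prob_space)
  also have "ennreal \<dots> \<le> ennreal (exp (t\<^sup>2 * (8 / l\<^sup>2 * expectation (\<lambda>\<omega>. exp (l * \<bar>X \<omega>\<bar>)))))"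
    by (intro ennreal_leI exp_ge_add_one_self)
  finally show ?thesis .
qed

lemma (in prob_space) nn_integral_exp_sum_le:
  fixes X :: "'i \<Rightarrow> 'a \<Rightarrow> real"
  assumes I: "finite I" "indep_vars (\<lambda>_. borel) X I"
    and bound: "\<And>i. i \<in> I \<Longrightarrow> (\<integral>\<^sup>+ \<omega>. ennreal (exp (t * X i \<omega>)) \<partial>M) \<le> ennreal (exp b)"
  shows "(\<integral>\<^sup>+ \<omega>. ennreal (exp (t * (\<Sum>i\<in>I. X i \<omega>))) \<partial>M) \<le> ennreal (exp (real (card I) * b))"
proof -
  have "indep_vars (\<lambda>_. borel) (\<lambda>i \<omega>. ennreal (exp (t * X i \<omega>))) I"
    by (rule indep_vars_compose2[OF I(2)]) measurable
  then have "(\<integral>\<^sup>+ \<omega>. (\<Prod>i\<in>I. ennreal (exp (t * X i \<omega>))) \<partial>M)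
      = (\<Prod>i\<in>I. \<integral>\<^sup>+ \<omega>. ennreal (exp (t * X i \<omega>)) \<partial>M)"
    using I(1) by (intro indep_vars_nn_integral) auto
  also have "\<dots> \<le> (\<Prod>i\<in>I. ennreal (exp b))"
    using bound by (intro prod_mono_ennreal)
  also have "\<dots> = ennreal (exp (real (card I) * b))"
    by (simp add: ennreal_power exp_of_nat_mult)
  finally show ?thesis
    using I(1) by (simp add: sum_distrib_left exp_sum prod_ennreal)
qed

text \<open>\<open>exp (s * \<bar>y\<bar>)\<close> is at most the sum of the exponentials for
  \<open>t = s\<close> and \<open>t = - s\<close>; this gives the factor 2.\<close>

lemma (in prob_space) exp_abs_moment_le:
  fixes Y :: "'a \<Rightarrow> real"
  assumes [measurable]: "Y \<in> borel_measurable M"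
    and bound: "\<And>t. \<bar>t\<bar> = s \<Longrightarrow> (\<integral>\<^sup>+ \<omega>. ennreal (exp (t * Y \<omega>)) \<partial>M) \<le> ennreal C" and "s \<ge> 0" "C \<ge> 0"
  shows "integrable M (\<lambda>\<omega>. exp (s * \<bar>Y \<omega>\<bar>))" "expectation (\<lambda>\<omega>. exp (s * \<bar>Y \<omega>\<bar>)) \<le> 2 * C"
proof -
  have "exp (s * \<bar>y\<bar>) \<le> exp (s * y) + exp (- s * y)" for y :: real
    by (cases "y \<ge> 0") (auto simp: abs_if)
  then have "(\<integral>\<^sup>+ \<omega>. ennreal (exp (s * \<bar>Y \<omega>\<bar>)) \<partial>M)
      \<le> (\<integral>\<^sup>+ \<omega>. ennreal (exp (s * Y \<omega>)) + ennreal (exp (- s * Y \<omega>)) \<partial>M)"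
    by (intro nn_integral_mono) (simp flip: ennreal_plus)
  also have "\<dots> = (\<integral>\<^sup>+ \<omega>. ennreal (exp (s * Y \<omega>)) \<partial>M) + (\<integral>\<^sup>+ \<omega>. ennreal (exp (- s * Y \<omega>)) \<partial>M)"
    by (rule nn_integral_add) measurable
  also have "\<dots> \<le> ennreal C + ennreal C"
    using \<open>s \<ge> 0\<close> by (intro add_mono bound) auto
  also have "\<dots> = ennreal (2 * C)"
    using \<open>C \<ge> 0\<close> by (simp flip: ennreal_plus)
  finally have le: "(\<integral>\<^sup>+ \<omega>. ennreal (exp (s * \<bar>Y \<omega>\<bar>)) \<partial>M) \<le> ennreal (2 * C)" .
  show "integrable M (\<lambda>\<omega>. exp (s * \<bar>Y \<omega>\<bar>))"
    using le by (intro integrableI_nonneg) (auto simp: less_top[symmetric] top_unique)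
  then show "expectation (\<lambda>\<omega>. exp (s * \<bar>Y \<omega>\<bar>)) \<le> 2 * C"
    using le \<open>C \<ge> 0\<close> by (simp add: nn_integral_eq_integral)
qed

section \<open>Weak convergence and uniform integrability\<close>

text \<open>Clamping changes \<open>y\<close> only when its modulus exceeds \<open>L\<close>; the
  change is then at most \<open>\<bar>y\<bar>\<close>, which is at most
  \<open>y\<^sup>2 / L\<close>.\<close>

lemma abs_diff_clamp_le:
  fixes y L :: real
  assumes "L > 0"
  shows "\<bar>y - max (- L) (min L y)\<bar> \<le> y\<^sup>2 / L"
proof -
  have "\<bar>y\<bar> \<le> y\<^sup>2 / L" if "L \<le> \<bar>y\<bar>"
  proof -
    have "\<bar>y\<bar> * L \<le> \<bar>y\<bar> * \<bar>y\<bar>"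
      using that by (intro mult_left_mono) auto
    then show ?thesis
      using assms by (simp add: pos_le_divide_eq power2_eq_square)
  qed
  moreover have "0 \<le> y\<^sup>2 / L"
    using assms by simp
  ultimately show ?thesis
    using assms by (auto simp: max_def min_def abs_if split: if_splits)
qed

text \<open>The clamping error depends on the measure only through the moment bound
  \<open>B\<close>, so it is uniform over any family sharing that bound.\<close>

lemma (in prob_space) integral_diff_clamp_le:
  fixes w V :: "'a \<Rightarrow> real"
  assumes [measurable]: "w \<in> borel_measurable M"
    and V: "integrable M V" "expectation V \<le> B" "\<And>x. (w x)\<^sup>2 \<le> V x" and "L > 0"
  shows "integrable M w" "\<bar>expectation w - expectation (\<lambda>x. max (- L) (min L (w x)))\<bar> \<le> B / L"
proof -
  \<comment> \<open>The square of \<open>\<bar>w x\<bar> - 1\<close> is nonnegative.\<close>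
  have "\<bar>w x\<bar> \<le> 1 + V x" for x
    using V(3)[of x] zero_le_power2[of "\<bar>w x\<bar> - 1"] zero_le_power2[of "w x"]
    unfolding power2_diff power2_abs by simp
  then have "\<bar>w x\<bar> \<le> \<bar>1 + V x\<bar>" for x
    by (meson abs_ge_self order_trans)
  then show int: "integrable M w"
    by (intro Bochner_Integration.integrable_bound[of M "\<lambda>x. 1 + V x" w]) (auto simp: V(1))
  have int_clamp: "integrable M (\<lambda>x. max (- L) (min L (w x)))"
    using int by (intro integrable_max integrable_min) auto
  have "\<bar>expectation w - expectation (\<lambda>x. max (- L) (min L (w x)))\<bar>
      = \<bar>expectation (\<lambda>x. w x - max (- L) (min L (w x)))\<bar>"
    using int int_clamp by simp
  also have "\<dots> \<le> expectation (\<lambda>x. \<bar>w x - max (- L) (min L (w x))\<bar>)"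
    by (rule integral_abs_bound)
  also have "\<dots> \<le> expectation (\<lambda>x. V x / L)"
  proof (rule integral_mono)
    fix x
    show "\<bar>w x - max (- L) (min L (w x))\<bar> \<le> V x / L"
      using abs_diff_clamp_le[OF \<open>L > 0\<close>, of "w x"] divide_right_mono[OF V(3)[of x], of L] \<open>L > 0\<close>
      by linarith
  qed (use int int_clamp V(1) in auto)
  also have "\<dots> \<le> B / L"
    using V(2) \<open>L > 0\<close> by (simp add: divide_right_mono)
  finally show "\<bar>expectation w - expectation (\<lambda>x. max (- L) (min L (w x)))\<bar> \<le> B / L" .
qed

text \<open>Weak convergence settles the clamped function, which is bounded and continuous; the
  moment bound on \<open>V\<close> controls the clamping error on both sides.\<close>

lemma weak_conv_integral_conv_of_bounded_square:
  fixes \<mu> :: "nat \<Rightarrow> real measure" and V w :: "real \<Rightarrow> real"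
  assumes distr: "\<And>n. real_distribution (\<mu> n)" "real_distribution \<nu>" and weak: "weak_conv_m \<mu> \<nu>"
    and V: "continuous_on UNIV V" "\<And>x. (w x)\<^sup>2 \<le> V x"
      "eventually (\<lambda>n. integrable (\<mu> n) V \<and> integral\<^sup>L (\<mu> n) V \<le> B) sequentially"
    and w: "continuous_on UNIV w"
  shows "eventually (\<lambda>n. integrable (\<mu> n) w) sequentially"
    "integrable \<nu> w" "(\<lambda>n. integral\<^sup>L (\<mu> n) w) \<longlonglongrightarrow> integral\<^sup>L \<nu> w"
proof -
  interpret \<mu>: real_distribution "\<mu> n" for n by (rule distr)
  interpret \<nu>: real_distribution \<nu> by (rule distr)
  have [measurable]: "V \<in> borel_measurable borel" "w \<in> borel_measurable borel"
    using V(1) w by (auto intro: borel_measurable_continuous_onI)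
  have V_nonneg: "V x \<ge> 0" for x
    using V(2)[of x] by (meson order_trans zero_le_power2)
  have bdd_conv: "(\<lambda>n. integral\<^sup>L (\<mu> n) f) \<longlonglongrightarrow> integral\<^sup>L \<nu> f"
    if "continuous_on UNIV f" "\<And>x. \<bar>f x\<bar> \<le> C" for f :: "real \<Rightarrow> real" and C :: real
    using that weak_conv_imp_integral_bdd_continuous_conv[OF distr weak, where f = f and B = C]
    by (simp add: continuous_on_eq_continuous_at)
  have trunc: "integrable \<nu> (\<lambda>x. min (V x) (real K))" "integrable (\<mu> n) (\<lambda>x. min (V x) (real K))" for n K
    by (auto intro!: \<nu>.integrable_const_bound[where B = K] \<mu>.integrable_const_bound[where B = K] simp: V_nonneg)
  \<comment> \<open>The limit measure must inherit the bound on \<open>V\<close>. The truncations of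
    \<open>V\<close> are bounded and continuous, so they pass to the weak limit, and Fatou then
    removes \<open>K\<close>.\<close>
  have trunc_le: "integral\<^sup>L \<nu> (\<lambda>x. min (V x) (real K)) \<le> B" for K
  proof (rule tendsto_upperbound)
    show "(\<lambda>n. integral\<^sup>L (\<mu> n) (\<lambda>x. min (V x) (real K))) \<longlonglongrightarrow> integral\<^sup>L \<nu> (\<lambda>x. min (V x) (real K))"
      by (rule bdd_conv[of _ "real K"]) (intro continuous_intros V(1), simp add: V_nonneg)
    show "eventually (\<lambda>n. integral\<^sup>L (\<mu> n) (\<lambda>x. min (V x) (real K)) \<le> B) sequentially"
      using V(3)
    proof eventually_elim
      case (elim n)
      then have "integral\<^sup>L (\<mu> n) (\<lambda>x. min (V x) (real K)) \<le> integral\<^sup>L (\<mu> n) V"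
        by (intro integral_mono trunc) auto
      then show ?case
        using elim by linarith
    qed
  qed simp
  have lim: "(\<lambda>K. min (V x) (real K)) \<longlonglongrightarrow> V x" for x
  proof (rule tendsto_eventually)
    show "eventually (\<lambda>K. min (V x) (real K) = V x) sequentially"
      using eventually_ge_at_top[of "nat \<lceil>V x\<rceil>"] by eventually_elim linarith
  qed
  have \<nu>V: "integrable \<nu> V" "integral\<^sup>L \<nu> V \<le> B"
    using integrable_expectation_le_of_tendsto[OF trunc(1) _ lim trunc_le] by (auto simp: V_nonneg)
  then have "B \<ge> 0"
    using V_nonneg by (meson Bochner_Integration.integral_nonneg order_trans)
  have w_distr: "w \<in> borel_measurable (\<mu> n)" "w \<in> borel_measurable \<nu>" for n
    by simp_all
  note \<nu>w = \<nu>.integral_diff_clamp_le[OF w_distr(2) \<nu>V V(2)]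
  show "integrable \<nu> w"
    by (rule \<nu>w(1)[OF zero_less_one])
  show "eventually (\<lambda>n. integrable (\<mu> n) w) sequentially"
    using V(3)
  proof eventually_elim
    case (elim n)
    then show ?case
      using \<mu>.integral_diff_clamp_le(1)[OF w_distr(1) _ _ V(2) zero_less_one] by blast
  qed
  show "(\<lambda>n. integral\<^sup>L (\<mu> n) w) \<longlonglongrightarrow> integral\<^sup>L \<nu> w"
  proof (rule tendstoI)
    fix e :: real assume "e > 0"
    \<comment> \<open>Clamping then costs less than \<open>e / 3\<close> under each measure, and the
      weak convergence of the clamped integrals uses the remaining third. Taking
      \<open>B + 1\<close> keeps \<open>L\<close> positive when \<open>B = 0\<close>.\<close>
    define L where "L = 4 * (B + 1) / e"
    have "L > 0"
      using \<open>B \<ge> 0\<close> \<open>e > 0\<close> by (simp add: L_def)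
    have "B / L < e / 3"
      using \<open>B \<ge> 0\<close> \<open>e > 0\<close> by (simp add: L_def field_simps add_nonneg_pos)
    let ?c = "\<lambda>x. max (- L) (min L (w x))"
    have "(\<lambda>n. integral\<^sup>L (\<mu> n) ?c) \<longlonglongrightarrow> integral\<^sup>L \<nu> ?c"
      using \<open>L > 0\<close> by (intro bdd_conv[of _ L] continuous_intros w) auto
    then have "eventually (\<lambda>n. dist (integral\<^sup>L (\<mu> n) ?c) (integral\<^sup>L \<nu> ?c) < e / 3) sequentially"
      by (rule tendstoD) (use \<open>e > 0\<close> in simp)
    with V(3) show "eventually (\<lambda>n. dist (integral\<^sup>L (\<mu> n) w) (integral\<^sup>L \<nu> w) < e) sequentially"
    proof eventually_elim
      case (elim n)
      have "\<bar>integral\<^sup>L (\<mu> n) w - integral\<^sup>L (\<mu> n) ?c\<bar> \<le> B / L"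
        using elim(1) by (intro \<mu>.integral_diff_clamp_le(2)[OF w_distr(1) _ _ V(2) \<open>L > 0\<close>]) blast+
      with elim(2) \<nu>w(2)[OF \<open>L > 0\<close>] \<open>B / L < e / 3\<close> show ?case
        unfolding dist_real_def by linarith
    qed
  qed
qed

section \<open>Normalized sums and the limit theorem\<close>

text \<open>Each summand is evaluated at a parameter of order \<open>1 / sqrt n\<close>, which
  eventually falls below \<open>l / 2\<close> however small \<open>l\<close> is. The
  \<open>n\<close> exponents, quadratic in that parameter, then add up to a constant.\<close>

lemma (in prob_space) eventually_exp_moment_normalized_sum_le:
  fixes X :: "nat \<Rightarrow> 'a \<Rightarrow> real"
  assumes indep: "indep_vars (\<lambda>_. borel) X UNIV"
    and distr: "\<And>i. distr M borel (X i) = distr M borel (X 0)"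
    and X0: "integrable M (X 0)" "expectation (X 0) = 0"
    and l: "l > 0" "integrable M (\<lambda>\<omega>. exp (l * \<bar>X 0 \<omega>\<bar>))"
    and "\<sigma> > 0" "s \<ge> 0"
  shows "\<exists>B. eventually (\<lambda>n. integrable M (\<lambda>\<omega>. exp (s * \<bar>(\<Sum>i<n. X i \<omega>) / sqrt (real n * \<sigma>\<^sup>2)\<bar>)) \<and>
    expectation (\<lambda>\<omega>. exp (s * \<bar>(\<Sum>i<n. X i \<omega>) / sqrt (real n * \<sigma>\<^sup>2)\<bar>)) \<le> B) sequentially"
proof -
  have [measurable]: "X i \<in> borel_measurable M" for i
    using indep by (simp add: indep_vars_def2)
  define D where "D = 8 / l\<^sup>2 * expectation (\<lambda>\<omega>. exp (l * \<bar>X 0 \<omega>\<bar>))"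
  have mgf: "(\<integral>\<^sup>+ \<omega>. ennreal (exp (t * X i \<omega>)) \<partial>M) \<le> ennreal (exp (t\<^sup>2 * D))"
    if "\<bar>t\<bar> \<le> l / 2" for t i
  proof -
    have "(\<integral>\<^sup>+ \<omega>. ennreal (exp (t * X i \<omega>)) \<partial>M) = (\<integral>\<^sup>+ x. ennreal (exp (t * x)) \<partial>distr M borel (X i))"
      by (simp add: nn_integral_distr)
    also have "\<dots> = (\<integral>\<^sup>+ \<omega>. ennreal (exp (t * X 0 \<omega>)) \<partial>M)"
      unfolding distr[of i] by (simp add: nn_integral_distr)
    also have "\<dots> \<le> ennreal (exp (t\<^sup>2 * D))"
      unfolding D_def by (rule nn_integral_exp_le_exp_quadratic[OF X0 l that])
    finally show ?thesis .
  qed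
  have "((\<lambda>n. s / sqrt (real n * \<sigma>\<^sup>2)) \<longlonglongrightarrow> 0)"
    using \<open>\<sigma> > 0\<close> by real_asymp
  then have "eventually (\<lambda>n. s / sqrt (real n * \<sigma>\<^sup>2) < l / 2) sequentially"
    by (rule order_tendstoD) (use l in simp)
  \<comment> \<open>Positivity of \<open>n\<close> is used below to cancel \<open>n\<close> against
    the square of the normalization.\<close>
  with eventually_gt_at_top[of 0]
  have "eventually (\<lambda>n. integrable M (\<lambda>\<omega>. exp (s * \<bar>(\<Sum>i<n. X i \<omega>) / sqrt (real n * \<sigma>\<^sup>2)\<bar>)) \<and>
    expectation (\<lambda>\<omega>. exp (s * \<bar>(\<Sum>i<n. X i \<omega>) / sqrt (real n * \<sigma>\<^sup>2)\<bar>)) \<le> 2 * exp (s\<^sup>2 / \<sigma>\<^sup>2 * D)) sequentially"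
  proof eventually_elim
    case (elim n)
    let ?r = "sqrt (real n * \<sigma>\<^sup>2)"
    let ?U = "\<lambda>\<omega>. (\<Sum>i<n. X i \<omega>) / ?r"
    have "(\<integral>\<^sup>+ \<omega>. ennreal (exp (t * ?U \<omega>)) \<partial>M) \<le> ennreal (exp (s\<^sup>2 / \<sigma>\<^sup>2 * D))" if "\<bar>t\<bar> = s" for t
    proof -
      have "\<bar>t / ?r\<bar> \<le> l / 2"
        using elim that by (simp add: abs_divide abs_mult real_sqrt_mult)
      then have "(\<integral>\<^sup>+ \<omega>. ennreal (exp (t / ?r * (\<Sum>i<n. X i \<omega>))) \<partial>M)
          \<le> ennreal (exp (real (card {..<n}) * ((t / ?r)\<^sup>2 * D)))"
        by (intro nn_integral_exp_sum_le mgf indep_vars_subset[OF indep]) auto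
      also have "real (card {..<n}) * ((t / ?r)\<^sup>2 * D) = s\<^sup>2 / \<sigma>\<^sup>2 * D"
        using elim(1) \<open>\<sigma> > 0\<close> by (simp add: power_divide flip: that)
      finally show ?thesis
        by (simp add: mult_ac)
    qed
    then show ?case
      using \<open>s \<ge> 0\<close> by (intro conjI exp_abs_moment_le[where C = "exp (s\<^sup>2 / \<sigma>\<^sup>2 * D)"]) auto
  qed
  then show ?thesis by blast
qed

text \<open>Integrability is part of the conclusion because the Bochner integral of a non-integrable
  function is 0 by convention, so a bare limit of expectations could hold vacuously.\<close>

theorem theorem1p7:
  fixes M :: "'a measure" and X :: "nat \<Rightarrow> 'a \<Rightarrow> real"
    and N :: "'b measure" and Z :: "'b \<Rightarrow> real"
    and \<sigma> R c :: real and w :: "real \<Rightarrow> real"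
    and U :: "nat \<Rightarrow> 'a \<Rightarrow> real"
  assumes "prob_space M"
    and "prob_space.indep_vars M (\<lambda>_. borel) X UNIV"
    and "\<And>i. distr M borel (X i) = distr M borel (X 0)"
    and "\<And>i. integrable M (X i)" and "\<And>i. prob_space.expectation M (X i) = 0"
    and "\<sigma> > 0"
    and "\<And>i. integrable M (\<lambda>\<omega>. (X i \<omega>)\<^sup>2)" and "\<And>i. prob_space.variance M (X i) = \<sigma>\<^sup>2"
    and "R \<ge> 0" and "\<And>i. poincare_constant M (X i) = ennreal R"
    and "prob_space N" and "distributed N lborel Z std_normal_density"
    and "c < 1 / (12 * sqrt R)"
    and "continuous_on UNIV w" and "\<And>t. \<bar>w t\<bar> \<le> exp (c * \<bar>t\<bar>)"
  defines "U \<equiv> \<lambda>n \<omega>. (\<Sum>i<n. X i \<omega>) / sqrt (real n * \<sigma>\<^sup>2)"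
  shows "(\<forall>\<^sub>F n in sequentially. integrable M (\<lambda>\<omega>. w (U n \<omega>)))
    \<and> integrable N (\<lambda>\<omega>. w (Z \<omega>))
    \<and> (\<lambda>n. prob_space.expectation M (\<lambda>\<omega>. w (U n \<omega>)))
         \<longlonglongrightarrow> prob_space.expectation N (\<lambda>\<omega>. w (Z \<omega>))"
proof -
  interpret prob_space M by (rule assms(1))
  have [measurable]: "X i \<in> borel_measurable M" for i
    using assms(4) by blast
  have [measurable]: "U n \<in> borel_measurable M" for n
    unfolding U_def by measurable
  have w_meas [measurable]: "w \<in> borel_measurable borel"
    using assms(14) by (rule borel_measurable_continuous_onI)
  \<comment> \<open>This gives \<open>R * k\<^sup>2 = R / (4 * (R + 1))\<close>; the summand 1 keeps
    \<open>k\<close> well defined and positive for every \<open>R \<ge> 0\<close>.\<close>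
  define k where "k = 1 / (2 * sqrt (R + 1))"
  have "k > 0" "R * k\<^sup>2 \<le> 1 / 4"
    using assms(9) by (simp_all add: k_def power_divide power_mult_distrib field_simps)
  then have exp_int: "integrable M (\<lambda>\<omega>. exp (2 * k * \<bar>X 0 \<omega>\<bar>))"
    using assms(4,9,10) by (intro poincare_imp_exp_moment) auto
  \<comment> \<open>The square of \<open>w\<close> grows with rate \<open>2 * c\<close>; the maximum
    covers negative \<open>c\<close>, since the moment bound asks for
    \<open>s \<ge> 0\<close>.\<close>
  define s where "s = 2 * max 0 c"
  obtain B where B: "eventually (\<lambda>n. integrable M (\<lambda>\<omega>. exp (s * \<bar>U n \<omega>\<bar>)) \<and>
      expectation (\<lambda>\<omega>. exp (s * \<bar>U n \<omega>\<bar>)) \<le> B) sequentially"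
    using eventually_exp_moment_normalized_sum_le[OF assms(2,3,4,5) _ exp_int assms(6), of s] \<open>k > 0\<close>
    unfolding U_def by (auto simp: s_def)
  have w_le: "(w x)\<^sup>2 \<le> exp (s * \<bar>x\<bar>)" for x
  proof -
    have "(w x)\<^sup>2 \<le> (exp (c * \<bar>x\<bar>))\<^sup>2"
      using power_mono[OF assms(15)[of x] abs_ge_zero, of 2] by simp
    also have "\<dots> = exp (2 * c * \<bar>x\<bar>)"
      by (simp add: mult.assoc flip: exp_double)
    also have "\<dots> \<le> exp (s * \<bar>x\<bar>)"
      by (auto simp: s_def intro!: mult_right_mono)
    finally show ?thesis .
  qed
  have weak: "weak_conv_m (\<lambda>n. distr M borel (U n)) std_normal_distribution"
    unfolding U_def by (rule central_limit_theorem_zero_mean[OF assms(2,5-8,3)])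
  have real_distr: "real_distribution (distr M borel (U n))" for n
    by (intro real_distribution_distr) simp
  have B': "eventually (\<lambda>n. integrable (distr M borel (U n)) (\<lambda>x. exp (s * \<bar>x\<bar>)) \<and>
      integral\<^sup>L (distr M borel (U n)) (\<lambda>x. exp (s * \<bar>x\<bar>)) \<le> B) sequentially"
    using B by (simp add: integrable_distr_eq integral_distr)
  have cont: "continuous_on UNIV (\<lambda>x::real. exp (s * \<bar>x\<bar>))"
    by (intro continuous_intros)
  note conv = weak_conv_integral_conv_of_bounded_square
    [OF real_distr real_dist_normal_dist weak cont w_le B' assms(14)]
  have [measurable]: "Z \<in> borel_measurable N"
    using distributed_measurable[OF assms(12)] by simp
  \<comment> \<open>The density is given relative to \<open>lborel\<close>, which has the same
    measurable sets as \<open>borel\<close>, so both push-forwards agree.\<close>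
  have Z: "distr N borel Z = std_normal_distribution"
    using distributed_distr_eq_density[OF assms(12)] distr_cong[of N N borel lborel Z Z] by simp
  show ?thesis
  proof (intro conjI)
    show "\<forall>\<^sub>F n in sequentially. integrable M (\<lambda>\<omega>. w (U n \<omega>))"
      using conv(1) by (simp add: integrable_distr_eq)
    show "integrable N (\<lambda>\<omega>. w (Z \<omega>))"
      using conv(2) unfolding Z[symmetric] by (simp add: integrable_distr_eq)
    show "(\<lambda>n. expectation (\<lambda>\<omega>. w (U n \<omega>))) \<longlonglongrightarrow> prob_space.expectation N (\<lambda>\<omega>. w (Z \<omega>))"
      using conv(3) unfolding Z[symmetric] by (simp add: integral_distr)
  qed
qed

end
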